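(* If $P$ is a reflexive cone of a Banach space $X$ with a closed, bounded base $B$, then $P$ does not contain an infinite dimensional closed cone $K$ such that the space $Y=P-P$, ordered by the cone $K$, is a locally solid vector lattice.
   Context: All spaces are real. $B_X$ is the closed unit ball of $X$. A cone of $X$ is a nonempty convex set $P\subseteq X$ with $\lambda P\subseteq P$ for every real $\lambda\ge 0$. $P$ is reflexive if $P\cap B_X$ is weakly compact. A base for $P$ is a convex subset $B$ of $P$ such that for each $x\in P$, $x\neq 0$, there is a unique real number $f(x)>0$ with $x/f(x)\in B$. A cone $K$ is infinite dimensional if the subspace $K-K$ is infinite dimensional. The space $Y=P-P$ carries the norm of $X$, and the order defined by $K$ is $x\le y\iff y-x\in K$. A normed space $Y$ ordered by a pointed cone is a locally solid vector lattice if it is a vector lattice and there is a real constant $a>0$ such that $x,y\in Y$, $|x|\le|y|$ implies $\|x\|\le a\|y\|$. *)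

theory Defs
  imports "HOL-Analysis.Analysis" "HOL-Algebra.Lattice"
begin

text \<open>Cones are not required to be closed or pointed: a cone is a set satisfying the
  library predicate \<^const>\<open>convex_cone\<close>.\<close>

definition weak_topology :: "'a::real_normed_vector topology" where
  "weak_topology =
     topology_generated_by {blinfun_apply \<phi> -` U | (\<phi> :: 'a \<Rightarrow>\<^sub>L real) U. open U}"

definition reflexive_cone :: "'a::real_normed_vector set \<Rightarrow> bool" where
  "reflexive_cone P \<longleftrightarrow> convex_cone P \<and> compactin weak_topology (P \<inter> cball 0 1)"

definition cone_base :: "'a::real_vector set \<Rightarrow> 'a set \<Rightarrow> bool" where
  "cone_base P B \<longleftrightarrow>
     convex B \<and> B \<subseteq> P \<and> (\<forall>x\<in>P. x \<noteq> 0 \<longrightarrow> (\<exists>!t::real. t > 0 \<and> x /\<^sub>R t \<in> B))"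

text \<open>The algebraic difference of a cone with itself, which is its linear span; not the
  set-theoretic difference.\<close>

definition cone_span :: "'a::real_vector set \<Rightarrow> 'a set" where
  "cone_span P = {x - y | x y. x \<in> P \<and> y \<in> P}"

definition infinite_dim_cone :: "'a::real_vector set \<Rightarrow> bool" where
  "infinite_dim_cone K \<longleftrightarrow> \<not> (\<exists>F. finite F \<and> cone_span K \<subseteq> span F)"

definition ordered_by :: "'a::real_vector set \<Rightarrow> 'a set \<Rightarrow> 'a gorder" where
  "ordered_by Y K = \<lparr>carrier = Y, eq = (=), le = (\<lambda>x y. y - x \<in> K)\<rparr>"

definition pointed_cone :: "'a::real_vector set \<Rightarrow> bool" where
  "pointed_cone K \<longleftrightarrow> convex_cone K \<and> K \<inter> uminus ` K = {0}"

text \<open>The order of \<^term>\<open>ordered_by Y K\<close> is compatible with the linear structure for every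
  cone \<^term>\<open>K\<close>, so a vector lattice only requires existence of binary suprema and infima,
  taken within \<^term>\<open>Y\<close>.\<close>

definition vector_lattice :: "'a::real_vector set \<Rightarrow> 'a set \<Rightarrow> bool" where
  "vector_lattice Y K \<longleftrightarrow>
     subspace Y \<and> pointed_cone K \<and> K \<subseteq> Y \<and> Lattice.lattice (ordered_by Y K)"

definition lattice_abs :: "'a::real_vector set \<Rightarrow> 'a set \<Rightarrow> 'a \<Rightarrow> 'a" where
  "lattice_abs Y K x = join (ordered_by Y K) x (- x)"

definition locally_solid_vector_lattice :: "'a::real_normed_vector set \<Rightarrow> 'a set \<Rightarrow> bool" where
  "locally_solid_vector_lattice Y K \<longleftrightarrow>
     vector_lattice Y K \<and>
     (\<exists>a>0. \<forall>x\<in>Y. \<forall>y\<in>Y.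
        le (ordered_by Y K) (lattice_abs Y K x) (lattice_abs Y K y) \<longrightarrow> norm x \<le> a * norm y)"

end

theory Submission
  imports Defs
begin

text \<open>
  In the norm of \<open>X\<close>, a closed infinite dimensional lattice cone \<open>K\<close> inside \<open>P\<close> behaves like
  the positive cone of an AL-space: the closed bounded base makes the norm of positive elements nearly
  additive, and local solidity transfers this to differences of disjoint elements. Such a space
  contains a copy of \<open>\<ell>\<^sub>1\<close> spanned by a disjoint sequence, and the unit vectors of \<open>\<ell>\<^sub>1\<close> do not lie
  in a weakly compact set, while \<open>P \<inter> cball 0 1\<close> is one.

  The contradiction can be read off from convex hulls of the disjoint sequence.

  The cone \<open>K\<close> contains a sequence of pairwise disjoint nonzero elements
  (\<open>infinite_dim_imp_disjoint_sequence\<close>). Since \<open>K\<close> is closed, the order is Archimedean, and an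
  element with no atom below it can be split into disjoint parts indefinitely. If there is an atom
  below every nonzero positive element, then a finite maximal disjoint set of atoms would span
  \<open>K\<close>, so that disjoint atoms can be chosen one after the other.

  Scale this sequence into the base, and the base into the unit ball. If \<open>u\<close> is a convex
  combination of terms before some \<open>M\<close> and \<open>v\<close> one of terms from \<open>M\<close> on, then \<open>u\<close> and \<open>v\<close>
  are disjoint, so the absolute value of \<open>u - v\<close> is \<open>u + v\<close> (\<open>lattice_abs_diff_disjoint\<close>).
  Hence \<open>norm (u - v)\<close> is at least a constant times \<open>norm (u + v)\<close>. As \<open>(u + v) / 2\<close> lies in the
  base, whose distance from \<open>0\<close> is positive, \<open>norm (u - v)\<close> has a positive lower bound independent
  of \<open>u\<close>, \<open>v\<close> and \<open>M\<close>.

  Weak compactness says the opposite (\<open>weakly_compact_imp_close_convex_combinations\<close>). The closed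
  convex hulls of the tails of the sequence decrease and are weakly closed by Mazur's theorem, so
  they have a common point, which convex combinations of both kinds approximate in norm. Mazur's
  theorem rests on the Hahn--Banach theorem, which is obtained here from minimal sublinear
  functionals.
\<close>

section \<open>Dominated linear functionals\<close>

definition sublinear :: "('a::real_vector \<Rightarrow> real) \<Rightarrow> bool" where
  "sublinear p \<longleftrightarrow> (\<forall>x y. p (x + y) \<le> p x + p y) \<and> (\<forall>t\<ge>0. \<forall>x. p (t *\<^sub>R x) = t * p x)"

lemma sublinearI:
  assumes sub: "\<And>x y. p (x + y) \<le> p x + p y"
    and hom: "\<And>t x. t > 0 \<Longrightarrow> p (t *\<^sub>R x) \<le> t * p x"
  shows "sublinear p"
proof -
  have "p 0 \<ge> 0"
    using sub[of 0 0] by simp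
  moreover have "p 0 \<le> 0"
    using hom[of "1/2" 0] by simp
  ultimately have p0: "p 0 = 0"
    by simp
  have "p (t *\<^sub>R x) = t * p x" if "t > 0" for t x
  proof (rule antisym)
    have "p ((1 / t) *\<^sub>R t *\<^sub>R x) \<le> (1 / t) * p (t *\<^sub>R x)"
      using that by (intro hom) simp
    then show "t * p x \<le> p (t *\<^sub>R x)"
      using that by (simp add: field_simps)
  qed (rule hom[OF that])
  then have "\<forall>t\<ge>0. \<forall>x. p (t *\<^sub>R x) = t * p x"
    using p0 by (metis less_eq_real_def mult_zero_left scaleR_zero_left)
  then show ?thesis
    using sub by (simp add: sublinear_def)
qed

lemma sublinear_add: "sublinear p \<Longrightarrow> p (x + y) \<le> p x + p y"
  by (simp add: sublinear_def)

lemma sublinear_scaleR: "sublinear p \<Longrightarrow> t \<ge> 0 \<Longrightarrow> p (t *\<^sub>R x) = t * p x"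
  by (simp add: sublinear_def)

lemma sublinear_zero: "sublinear p \<Longrightarrow> p 0 = 0"
  using sublinear_scaleR[of p 0 0] by simp

lemma sublinear_uminus: "sublinear p \<Longrightarrow> - p (- x) \<le> p x"
  using sublinear_add[of p x "- x"] by (simp add: sublinear_zero)

lemma sublinear_norm: "sublinear norm"
  by (rule sublinearI) (auto simp: norm_triangle_ineq)

text \<open>A sublinear functional below \<open>p\<close> that is at most \<open>- d\<close> at \<open>- w\<close> is at most
  \<open>p (x + t *\<^sub>R w) - t * d\<close> at \<open>x = (x + t *\<^sub>R w) + t *\<^sub>R (- w)\<close>. The infimum of these numbers
  is the witness: it is finite because \<open>p \<ge> d\<close> on \<open>D\<close>, and subadditive because \<open>D\<close> is
  convex.

  Both steps towards a separating functional use this lemma: a point \<open>y\<close> in place of \<open>D\<close> shows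
  that minimal sublinear functionals are linear, and the translate of a convex set makes the
  functional separate.\<close>

lemma sublinear_lower_on_convex:
  fixes p :: "'a::real_vector \<Rightarrow> real"
  assumes p: "sublinear p" and D: "convex D" and ge: "\<And>w. w \<in> D \<Longrightarrow> d \<le> p w"
  obtains q where "sublinear q" "q \<le> p" "\<And>w. w \<in> D \<Longrightarrow> q (- w) \<le> - d"
proof (cases "D = {}")
  case True
  with that[of p] p show thesis by simp
next
  case False
  then obtain w0 where w0: "w0 \<in> D" by blast
  define I where "I = {0::real..} \<times> D"
  define g where "g x = (\<lambda>(t, w). p (x + t *\<^sub>R w) - t * d)" for x
  define q where "q x = Inf (g x ` I)" for x
  have bdd: "bdd_below (g x ` I)" for x
  proof (rule bdd_belowI2)
    fix i assume "i \<in> I"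
    then obtain t w where i: "i = (t, w)" "t \<ge> 0" "w \<in> D"
      by (auto simp: I_def)
    have "t * d \<le> p (t *\<^sub>R w)"
      using ge[of w] i by (simp add: sublinear_scaleR[OF p] mult_left_mono)
    also have "p (t *\<^sub>R w) \<le> p (x + t *\<^sub>R w) + p (- x)"
      using sublinear_add[OF p, of "x + t *\<^sub>R w" "- x"] by simp
    finally show "- p (- x) \<le> g x i"
      by (simp add: g_def i)
  qed
  have lower: "q x \<le> p (x + t *\<^sub>R w) - t * d" if "t \<ge> 0" "w \<in> D" for x t w
  proof -
    have "q x \<le> g x (t, w)"
      unfolding q_def using that by (intro cINF_lower bdd) (simp add: I_def)
    then show ?thesis by (simp add: g_def)
  qed
  have greatest: "c \<le> q x"
    if "\<And>t w. t \<ge> 0 \<Longrightarrow> w \<in> D \<Longrightarrow> c \<le> p (x + t *\<^sub>R w) - t * d" for c x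
    unfolding q_def
  proof (rule cINF_greatest)
    show "I \<noteq> {}" using w0 by (auto simp: I_def)
  qed (auto simp: I_def g_def that)
  have "sublinear q"
  proof (rule sublinearI)
    fix x y
    have *: "q (x + y) \<le> (p (x + s *\<^sub>R v) - s * d) + (p (y + t *\<^sub>R w) - t * d)"
      if st: "s \<ge> 0" "t \<ge> 0" and vw: "v \<in> D" "w \<in> D" for s t v w
    proof -
      obtain u where u: "u \<in> D" "(s + t) *\<^sub>R u = s *\<^sub>R v + t *\<^sub>R w"
      proof (cases "s + t = 0")
        case True
        then have "s = 0" "t = 0" using st by auto
        then show thesis using that[of v] vw by simp
      next
        case False
        have "(s / (s + t)) *\<^sub>R v + (t / (s + t)) *\<^sub>R w \<in> D"
          using st False vw
          by (intro convexD[OF D]) (auto simp flip: add_divide_distrib)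
        then show thesis
          using that[of "(s / (s + t)) *\<^sub>R v + (t / (s + t)) *\<^sub>R w"] False
          by (simp add: scaleR_add_right)
      qed
      have "q (x + y) \<le> p (x + y + (s + t) *\<^sub>R u) - (s + t) * d"
        using st u by (intro lower) auto
      also have "x + y + (s + t) *\<^sub>R u = (x + s *\<^sub>R v) + (y + t *\<^sub>R w)"
        unfolding u(2) by (simp add: algebra_simps)
      also have "p \<dots> \<le> p (x + s *\<^sub>R v) + p (y + t *\<^sub>R w)"
        by (rule sublinear_add[OF p])
      finally show ?thesis by (simp add: algebra_simps)
    qed
    have "q (x + y) - (p (x + s *\<^sub>R v) - s * d) \<le> q y" if "s \<ge> 0" "v \<in> D" for s v
      by (rule greatest) (use *[of s _ v] that in \<open>simp add: algebra_simps\<close>)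
    then have "q (x + y) - q y \<le> q x"
      by (intro greatest) (simp add: algebra_simps)
    then show "q (x + y) \<le> q x + q y" by simp
  next
    fix r :: real and x assume r: "r > 0"
    have "q (r *\<^sub>R x) / r \<le> q x"
    proof (rule greatest)
      fix t w assume "t \<ge> (0::real)" "w \<in> D"
      then have "q (r *\<^sub>R x) \<le> p (r *\<^sub>R x + (r * t) *\<^sub>R w) - (r * t) * d"
        using r by (intro lower) auto
      also have "r *\<^sub>R x + (r * t) *\<^sub>R w = r *\<^sub>R (x + t *\<^sub>R w)"
        by (simp add: scaleR_add_right)
      also have "p \<dots> = r * p (x + t *\<^sub>R w)"
        using r by (intro sublinear_scaleR[OF p]) simp
      finally show "q (r *\<^sub>R x) / r \<le> p (x + t *\<^sub>R w) - t * d"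
        using r by (simp add: field_simps)
    qed
    then show "q (r *\<^sub>R x) \<le> r * q x"
      using r by (simp add: field_simps)
  qed
  moreover have "q \<le> p"
    using lower[of 0 w0] w0 by (intro le_funI) simp
  moreover have "q (- w) \<le> - d" if "w \<in> D" for w
    using lower[of 1 w "- w"] that by (simp add: sublinear_zero[OF p])
  ultimately show thesis by (rule that)
qed

text \<open>A minimal sublinear functional cannot be lowered at any point, so it equals the functional
  of \<open>sublinear_lower_on_convex\<close> for \<open>D = {y}\<close> and \<open>d = q y\<close>. That makes it odd.\<close>

lemma minimal_sublinear_imp_linear:
  assumes q: "sublinear q" and min: "\<And>r. sublinear r \<Longrightarrow> r \<le> q \<Longrightarrow> r = q"
  shows "linear q"
proof -
  have odd: "q (- y) = - q y" for y
  proof (rule antisym)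
    obtain r where "sublinear r" "r \<le> q" "\<And>w. w \<in> {y} \<Longrightarrow> r (- w) \<le> - q y"
      using sublinear_lower_on_convex[OF q, of "{y}" "q y"] by auto
    then show "q (- y) \<le> - q y"
      using min[of r] by simp
    show "- q y \<le> q (- y)"
      using sublinear_uminus[OF q, of "- y"] by simp
  qed
  show ?thesis
  proof (rule linearI)
    fix x y
    have "q (- x + - y) \<le> q (- x) + q (- y)"
      by (rule sublinear_add[OF q])
    then show "q (x + y) = q x + q y"
      using sublinear_add[OF q, of x y] odd[of "x + y"] by (simp add: odd)
  next
    fix c :: real and x
    show "q (c *\<^sub>R x) = c *\<^sub>R q x"
    proof (cases "c \<ge> 0")
      case True
      then show ?thesis by (simp add: sublinear_scaleR[OF q])
    next
      case False
      then show ?thesis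
        using sublinear_scaleR[OF q, of "- c" x] odd[of "c *\<^sub>R x"] by simp
    qed
  qed
qed

text \<open>The Hahn--Banach theorem in the form of Koenig: by Zorn's lemma there is a minimal
  sublinear functional below \<open>p\<close>. A chain is bounded below at \<open>x\<close> by \<open>- p (- x)\<close>, so that its
  pointwise infimum is again sublinear.\<close>

theorem sublinear_dominates_linear:
  fixes p :: "'a::real_vector \<Rightarrow> real"
  assumes p: "sublinear p"
  obtains \<phi> where "linear \<phi>" "\<phi> \<le> p"
proof -
  define A where "A = {q. sublinear q \<and> q \<le> p}"
  define above where "above = (\<lambda>q r :: 'a \<Rightarrow> real. r \<le> q)"
  have "\<exists>m\<in>A. \<forall>a\<in>A. above m a \<longrightarrow> a = m"
  proof (rule predicate_Zorn)
    show "partial_order_on A (relation_of above A)"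
      by (rule partial_order_on_relation_ofI) (auto simp: above_def)
  next
    fix C assume "C \<in> Chains (relation_of above A)"
    then have CA: "C \<subseteq> A" and chain: "\<And>q r. q \<in> C \<Longrightarrow> r \<in> C \<Longrightarrow> q \<le> r \<or> r \<le> q"
      by (auto simp: Chains_def relation_of_def above_def)
    show "\<exists>u\<in>A. \<forall>a\<in>C. above a u"
    proof (cases "C = {}")
      case True
      then show ?thesis using p by (auto simp: A_def)
    next
      case False
      define u where "u x = (INF q\<in>C. q x)" for x
      have bdd: "bdd_below ((\<lambda>q. q x) ` C)" for x
      proof (rule bdd_belowI2)
        fix q assume "q \<in> C"
        then have q: "sublinear q" "q \<le> p" using CA by (auto simp: A_def)
        then have "q (- x) \<le> p (- x)" by (simp add: le_funD)
        then show "- p (- x) \<le> q x"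
          using sublinear_uminus[OF q(1), of x] by simp
      qed
      have lower: "u x \<le> q x" if "q \<in> C" for q x
        unfolding u_def using that by (intro cINF_lower bdd)
      have greatest: "c \<le> u x" if "\<And>q. q \<in> C \<Longrightarrow> c \<le> q x" for c x
        unfolding u_def by (rule cINF_greatest[OF False that])
      have "sublinear u"
      proof (rule sublinearI)
        fix x y
        have *: "u (x + y) \<le> q x + r y" if qr: "q \<in> C" "r \<in> C" for q r
        proof -
          obtain s where s: "s \<in> C" "s \<le> q" "s \<le> r"
            using chain[OF qr] qr by auto
          have "u (x + y) \<le> s (x + y)" by (rule lower[OF s(1)])
          also have "\<dots> \<le> s x + s y"
            using s CA by (intro sublinear_add) (auto simp: A_def)
          also have "\<dots> \<le> q x + r y"
            using s by (intro add_mono) (auto simp: le_funD)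
          finally show ?thesis .
        qed
        have "u (x + y) - q x \<le> u y" if "q \<in> C" for q
          using *[OF that] by (intro greatest) (simp add: algebra_simps)
        then have "u (x + y) - u y \<le> u x"
          by (intro greatest) (simp add: algebra_simps)
        then show "u (x + y) \<le> u x + u y" by simp
      next
        fix t :: real and x assume t: "t > 0"
        have "u (t *\<^sub>R x) / t \<le> u x"
        proof (rule greatest)
          fix q assume q: "q \<in> C"
          then have "sublinear q" using CA by (auto simp: A_def)
          then show "u (t *\<^sub>R x) / t \<le> q x"
            using lower[OF q, of "t *\<^sub>R x"] t by (simp add: sublinear_scaleR field_simps)
        qed
        then show "u (t *\<^sub>R x) \<le> t * u x"
          using t by (simp add: field_simps)
      qed
      moreover have "u \<le> p"
      proof -
        obtain q where q: "q \<in> C" using False by blast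
        then have "q \<le> p" using CA by (auto simp: A_def)
        moreover have "u \<le> q" using lower[OF q] by (rule le_funI)
        ultimately show ?thesis by simp
      qed
      ultimately show ?thesis
        using lower by (intro bexI[of _ u]) (auto simp: A_def above_def le_fun_def)
    qed
  qed
  then obtain m where m: "sublinear m" "m \<le> p"
      and min: "\<And>a. sublinear a \<Longrightarrow> a \<le> p \<Longrightarrow> a \<le> m \<Longrightarrow> a = m"
    by (auto simp: A_def above_def)
  show thesis
  proof (rule that)
    show "linear m"
      using m min by (intro minimal_sublinear_imp_linear) (auto intro: order_trans)
  qed (rule m)
qed

section \<open>Weak closedness of closed convex sets\<close>

text \<open>The vectors \<open>w = x - c\<close> with \<open>c \<in> C\<close> form a convex set on which the norm is at least the
  radius \<open>d\<close> of a ball around \<open>x\<close> that misses \<open>C\<close>. So some sublinear functional below the norm, and with it a linear one,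
  is at most \<open>- d\<close> at each \<open>- w\<close>.\<close>

lemma separating_functional:
  fixes C :: "'a::real_normed_vector set"
  assumes "convex C" "closed C" "x \<notin> C"
  obtains \<phi> :: "'a \<Rightarrow>\<^sub>L real" and d where "d > 0" "\<And>c. c \<in> C \<Longrightarrow> \<phi> c + d \<le> \<phi> x"
proof -
  obtain d where d: "d > 0" "ball x d \<inter> C = {}"
    using openE[of "- C" x] assms(2,3) open_Compl by (metis Compl_iff disjoint_eq_subset_Compl)
  define D where "D = (\<lambda>c. x - c) ` C"
  have D: "convex D"
    using convex_translation[OF convex_negations[OF assms(1)], of x]
    by (simp add: D_def image_image)
  have ge: "d \<le> norm w" if "w \<in> D" for w
    using that d by (force simp: D_def dist_norm)
  obtain q where q: "sublinear q" "q \<le> norm" "\<And>w. w \<in> D \<Longrightarrow> q (- w) \<le> - d"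
    using sublinear_lower_on_convex[OF sublinear_norm D ge] by blast
  obtain f where f: "linear f" "f \<le> q"
    using sublinear_dominates_linear[OF q(1)] by blast
  have le: "f y \<le> norm y" for y
    using f(2) q(2) by (meson le_funD order_trans)
  have "\<bar>f y\<bar> \<le> norm y" for y
    using le[of y] le[of "- y"] by (simp add: linear_neg[OF f(1)])
  then have bl: "bounded_linear f"
    using f(1) by (intro bounded_linear_intro[of f 1])
      (auto simp: linear_add linear_scale)
  show thesis
  proof (rule that[of d "Blinfun f"])
    fix c assume "c \<in> C"
    then have "q (- (x - c)) \<le> - d" by (intro q) (auto simp: D_def)
    then have "f (c - x) \<le> - d"
      using le_funD[OF f(2), of "c - x"] by simp
    then show "blinfun_apply (Blinfun f) c + d \<le> blinfun_apply (Blinfun f) x"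
      by (simp add: bounded_linear_Blinfun_apply[OF bl] linear_diff[OF f(1)])
  qed (rule d)
qed

lemma topspace_weak_topology [simp]:
  "topspace (weak_topology :: 'a::real_normed_vector topology) = UNIV"
proof -
  have "(UNIV :: 'a set) = blinfun_apply (0 :: 'a \<Rightarrow>\<^sub>L real) -` UNIV" by simp
  then have "(UNIV :: 'a set) \<in> {blinfun_apply \<phi> -` U | (\<phi> :: 'a \<Rightarrow>\<^sub>L real) U. open U}"
    by blast
  then show ?thesis
    unfolding weak_topology_def topology_generated_by_topspace by blast
qed

lemma openin_weak_topology_vimage:
  "open U \<Longrightarrow> openin weak_topology (blinfun_apply (\<phi> :: 'a::real_normed_vector \<Rightarrow>\<^sub>L real) -` U)"
  unfolding weak_topology_def by (rule topology_generated_by_Basis) blast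

text \<open>Mazur's theorem: a separating functional gives a weakly open half-space that contains a
  given point outside \<open>C\<close> and misses \<open>C\<close>.\<close>

lemma closed_convex_imp_weakly_closed:
  fixes C :: "'a::real_normed_vector set"
  assumes "convex C" "closed C"
  shows "closedin weak_topology C"
proof -
  have "openin weak_topology (- C)"
  proof (rule openin_subopen[THEN iffD2], intro ballI)
    fix x assume "x \<in> - C"
    then have "x \<notin> C" by simp
    then obtain \<phi> :: "'a \<Rightarrow>\<^sub>L real" and d
      where d: "d > 0" and sep: "\<And>c. c \<in> C \<Longrightarrow> \<phi> c + d \<le> \<phi> x"
      using separating_functional[OF assms] by blast
    have "openin weak_topology (blinfun_apply \<phi> -` {\<phi> x - d<..})"
      by (rule openin_weak_topology_vimage) simp
    moreover have "x \<in> blinfun_apply \<phi> -` {\<phi> x - d<..}"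
      using d by simp
    moreover have "blinfun_apply \<phi> -` {\<phi> x - d<..} \<subseteq> - C"
      using sep by force
    ultimately show "\<exists>T. openin weak_topology T \<and> x \<in> T \<and> T \<subseteq> - C"
      by blast
  qed
  then show ?thesis
    by (simp add: closedin_def Compl_eq_Diff_UNIV)
qed

text \<open>The sets are weakly closed and a finite intersection of them is one of them, so weak
  compactness applies through the finite intersection property.\<close>

lemma weakly_compact_decreasing_closed_convex:
  fixes C :: "nat \<Rightarrow> 'a::real_normed_vector set"
  assumes S: "compactin weak_topology S"
    and C: "\<And>n. convex (C n)" "\<And>n. closed (C n)" "\<And>n. C n \<noteq> {}" "\<And>n. C n \<subseteq> S"
    and dec: "decseq C"
  shows "(\<Inter>n. C n) \<noteq> {}"
proof -
  have "S \<inter> \<Inter> (range C) \<noteq> {}"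
  proof (rule compactin_fip[THEN iffD1, OF S, THEN conjunct2, rule_format], intro conjI ballI allI impI)
    fix X assume "X \<in> range C"
    then show "closedin weak_topology X"
      using C by (auto intro: closed_convex_imp_weakly_closed)
  next
    fix F assume F: "finite F \<and> F \<subseteq> range C"
    then obtain N where N: "finite N" "F = C ` N"
      using finite_subset_image[of F C UNIV] by auto
    have "C (Max (insert 0 N)) \<subseteq> C n" if "n \<in> N" for n
      using N(1) that by (intro decseqD[OF dec] Max_ge) auto
    then have "C (Max (insert 0 N)) \<subseteq> \<Inter> F"
      using N(2) by blast
    then show "S \<inter> \<Inter> F \<noteq> {}"
      using C(3,4)[of "Max (insert 0 N)"] by blast
  qed
  then show ?thesis by blast
qed

section \<open>Disjoint elements of a vector lattice\<close>

text \<open>For positive \<open>u\<close>, \<open>v\<close> this says that the infimum of \<open>u\<close> and \<open>v\<close> is \<open>0\<close>; it is phrased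
  with lower bounds because only suprema are used below.\<close>

definition disjoint_in :: "'a::real_vector set \<Rightarrow> 'a \<Rightarrow> 'a \<Rightarrow> bool" where
  "disjoint_in K u v \<longleftrightarrow> u \<in> K \<and> v \<in> K \<and> (\<forall>w\<in>K. u - w \<in> K \<longrightarrow> v - w \<in> K \<longrightarrow> w = 0)"

lemma disjoint_in_commute: "disjoint_in K u v \<longleftrightarrow> disjoint_in K v u"
  by (auto simp: disjoint_in_def)

lemma convex_cone_sum:
  assumes "convex_cone C" "\<And>i. i \<in> I \<Longrightarrow> f i \<in> C"
  shows "sum f I \<in> C"
  using assms(2)
  by (induction I rule: infinite_finite_induct)
    (auto intro: convex_cone_add[OF assms(1)] convex_cone_contains_0[OF assms(1)])

locale vector_lattice_on =
  fixes Y K :: "'a::real_vector set"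
  assumes vector_lattice: "vector_lattice Y K"
begin

abbreviation le_K (infix "\<preceq>" 50) where
  "x \<preceq> y \<equiv> y - x \<in> K"

abbreviation sup_K where
  "sup_K \<equiv> join (ordered_by Y K)"

lemma cone: "convex_cone K" and subspace: "subspace Y" and K_subset: "K \<subseteq> Y"
  using vector_lattice by (auto simp: vector_lattice_def pointed_cone_def)

lemmas K_add = convex_cone_add[OF cone]
  and K_scale = convex_cone_scaleR[OF cone]
  and K_zero = convex_cone_contains_0[OF cone]
  and Y_add = subspace_add[OF subspace]
  and Y_diff = subspace_diff[OF subspace]
  and Y_scale = subspace_scale[OF subspace]
  and Y_zero = subspace_0[OF subspace]

lemma K_pointed: "x \<in> K \<Longrightarrow> - x \<in> K \<Longrightarrow> x = 0"
proof -
  assume "x \<in> K" "- x \<in> K"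
  then have "x \<in> K \<inter> uminus ` K"
    by (auto intro: image_eqI[of _ _ "- x"])
  also have "K \<inter> uminus ` K = {0}"
    using vector_lattice by (simp add: vector_lattice_def pointed_cone_def)
  finally show "x = 0" by simp
qed

lemma le_K_trans: "x \<preceq> y \<Longrightarrow> y \<preceq> z \<Longrightarrow> x \<preceq> z"
  using K_add[of "y - x" "z - y"] by simp

lemma le_K_antisym: "x \<preceq> y \<Longrightarrow> y \<preceq> x \<Longrightarrow> x = y"
  using K_pointed[of "y - x"] by simp

lemma sup_K:
  assumes "x \<in> Y" "y \<in> Y"
  shows sup_K_closed: "sup_K x y \<in> Y" and sup_K_left: "x \<preceq> sup_K x y"
    and sup_K_right: "y \<preceq> sup_K x y"
    and sup_K_least: "\<And>z. z \<in> Y \<Longrightarrow> x \<preceq> z \<Longrightarrow> y \<preceq> z \<Longrightarrow> sup_K x y \<preceq> z"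
proof -
  interpret L: Lattice.lattice "ordered_by Y K"
    using vector_lattice by (simp add: vector_lattice_def)
  show "sup_K x y \<in> Y" "x \<preceq> sup_K x y" "y \<preceq> sup_K x y"
    using L.join_closed[of x y] L.join_left[of x y] L.join_right[of x y] assms
    by (simp_all add: ordered_by_def)
  show "sup_K x y \<preceq> z" if "z \<in> Y" "x \<preceq> z" "y \<preceq> z" for z
    using L.join_le[of x z y] that assms by (simp add: ordered_by_def)
qed

lemma disjoint_inD: "disjoint_in K u v \<Longrightarrow> w \<in> K \<Longrightarrow> w \<preceq> u \<Longrightarrow> w \<preceq> v \<Longrightarrow> w = 0"
  by (auto simp: disjoint_in_def)

lemma disjoint_in_mono:
  assumes "disjoint_in K u v" "u' \<in> K" "v' \<in> K" "u' \<preceq> u" "v' \<preceq> v"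
  shows "disjoint_in K u' v'"
  using assms le_K_trans by (auto simp: disjoint_in_def)

lemma disjoint_in_scaleR:
  assumes uv: "disjoint_in K u v" and t: "t \<ge> 0"
  shows "disjoint_in K u (t *\<^sub>R v)"
  unfolding disjoint_in_def
proof (intro conjI ballI impI)
  show "u \<in> K" "t *\<^sub>R v \<in> K"
    using uv t by (auto simp: disjoint_in_def K_scale)
  fix w assume w: "w \<in> K" "w \<preceq> u" "w \<preceq> t *\<^sub>R v"
  define c where "c = 1 / (1 + t)"
  have c: "c > 0" "c \<le> 1" "c * t \<le> 1"
    using t by (auto simp: c_def divide_simps)
  have v: "v \<in> K" using uv by (simp add: disjoint_in_def)
  have "c *\<^sub>R w = 0"
  proof (rule disjoint_inD[OF uv])
    show "c *\<^sub>R w \<in> K" using w c by (simp add: K_scale)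
    have "(u - w) + (1 - c) *\<^sub>R w \<in> K"
      using w c by (intro K_add K_scale) auto
    then show "c *\<^sub>R w \<preceq> u" by (simp add: algebra_simps)
    have "c *\<^sub>R (t *\<^sub>R v - w) + (1 - c * t) *\<^sub>R v \<in> K"
      using w c v by (intro K_add K_scale) auto
    then show "c *\<^sub>R w \<preceq> v" by (simp add: algebra_simps)
  qed
  then show "w = 0" using c by simp
qed

text \<open>The Riesz decomposition property: a positive \<open>z\<close> below \<open>v + w\<close> is the sum of a part
  below \<open>w\<close>, namely \<open>sup (z - v) 0\<close>, and a part below \<open>v\<close>. Both are below \<open>u\<close> if \<open>z\<close> is.\<close>

lemma disjoint_in_add:
  assumes uv: "disjoint_in K u v" and uw: "disjoint_in K u w"
  shows "disjoint_in K u (v + w)"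
  unfolding disjoint_in_def
proof (intro conjI ballI impI)
  have K: "u \<in> K" "v \<in> K" "w \<in> K"
    using uv uw by (auto simp: disjoint_in_def)
  then show "u \<in> K" "v + w \<in> K" by (auto intro: K_add)
  fix z assume z: "z \<in> K" "z \<preceq> u" "z \<preceq> v + w"
  define s where "s = sup_K (z - v) 0"
  have Y: "z - v \<in> Y" "0 \<in> Y" "z \<in> Y" "w \<in> Y"
    using K z K_subset by (auto intro: Y_diff Y_zero)
  have s: "z - v \<preceq> s" "s \<in> K"
    using sup_K_left[of "z - v" 0] sup_K_right[of "z - v" 0] Y by (auto simp: s_def)
  have sw: "s \<preceq> w" and sz: "s \<preceq> z"
    using Y K z by (auto simp: s_def algebra_simps intro!: sup_K_least)
  have "s = 0"
    using s sw le_K_trans[OF sz z(2)] by (intro disjoint_inD[OF uw])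
  then have "z \<preceq> v" using s by (simp add: algebra_simps)
  then show "z = 0" using disjoint_inD[OF uv] z by blast
qed

lemma convex_cone_disjoint_in:
  assumes "u \<in> K"
  shows "convex_cone {v. disjoint_in K u v}"
proof -
  have "disjoint_in K u 0"
    using assms K_pointed by (auto simp: disjoint_in_def K_zero)
  then show ?thesis
    by (simp add: convex_cone_iff disjoint_in_add disjoint_in_scaleR)
qed

text \<open>The excess \<open>d\<close> of \<open>u + v\<close> over the absolute value of \<open>u - v\<close> satisfies \<open>d \<le> 2 u\<close> and
  \<open>d \<le> 2 v\<close>.\<close>

lemma lattice_abs_diff_disjoint:
  assumes uv: "disjoint_in K u v"
  shows "lattice_abs Y K (u - v) = u + v"
proof -
  have K: "u \<in> K" "v \<in> K" using uv by (auto simp: disjoint_in_def)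
  then have Y: "u \<in> Y" "v \<in> Y" using K_subset by auto
  define s where "s = sup_K (u - v) (v - u)"
  have YY: "u - v \<in> Y" "v - u \<in> Y" using Y by (auto intro: Y_diff)
  have s: "u - v \<preceq> s" "v - u \<preceq> s"
    using sup_K_left[OF YY] sup_K_right[OF YY] by (simp_all add: s_def)
  have "u - v \<preceq> u + v" "v - u \<preceq> u + v"
    using K_add[OF K(1) K(1)] K_add[OF K(2) K(2)] by (simp_all add: algebra_simps)
  then have le: "s \<preceq> u + v"
    using sup_K_least[OF YY] Y_add[OF Y] by (simp add: s_def)
  have "(1/2) *\<^sub>R (u + v - s) = 0"
  proof (rule disjoint_inD[OF uv])
    show "(1/2) *\<^sub>R (u + v - s) \<in> K" using le by (intro K_scale) auto
    have half: "x = (1/2) *\<^sub>R x + (1/2) *\<^sub>R x" for x :: 'a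
      by (simp flip: scaleR_add_left)
    have "(1/2) *\<^sub>R (s - (v - u)) \<in> K" "(1/2) *\<^sub>R (s - (u - v)) \<in> K"
      using s by (auto intro!: K_scale)
    moreover have "u - (1/2) *\<^sub>R (u + v - s) = (1/2) *\<^sub>R (s - (v - u))"
      by (subst half[of u]) (simp add: algebra_simps)
    moreover have "v - (1/2) *\<^sub>R (u + v - s) = (1/2) *\<^sub>R (s - (u - v))"
      by (subst half[of v]) (simp add: algebra_simps)
    ultimately show "(1/2) *\<^sub>R (u + v - s) \<preceq> u" "(1/2) *\<^sub>R (u + v - s) \<preceq> v"
      by simp_all
  qed
  then show ?thesis by (simp add: lattice_abs_def s_def)
qed

lemma lattice_abs_of_positive: "u \<in> K \<Longrightarrow> lattice_abs Y K u = u"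
  using lattice_abs_diff_disjoint[of u 0] convex_cone_contains_0[OF convex_cone_disjoint_in, of u]
  by simp

text \<open>The supremum of disjoint elements is their sum, because \<open>u + v - sup_K u v\<close> is below both.\<close>

lemma disjoint_add_le:
  assumes uv: "disjoint_in K u v" and x: "x \<in> Y" "u \<preceq> x" "v \<preceq> x"
  shows "u + v \<preceq> x"
proof -
  have K: "u \<in> K" "v \<in> K" using uv by (auto simp: disjoint_in_def)
  then have Y: "u \<in> Y" "v \<in> Y" using K_subset by auto
  have s: "u \<preceq> sup_K u v" "v \<preceq> sup_K u v"
    using sup_K_left[OF Y] sup_K_right[OF Y] by simp_all
  have "sup_K u v \<preceq> u + v"
    using K Y by (intro sup_K_least Y_add) simp_all
  then have "u + v - sup_K u v = 0"
    using s by (intro disjoint_inD[OF uv]) (simp_all add: algebra_simps)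
  then show ?thesis
    using sup_K_least[OF Y x] by simp
qed

lemma disjoint_sum_le:
  assumes "finite F" "F \<subseteq> K" "x \<in> K"
    and "\<And>a b. a \<in> F \<Longrightarrow> b \<in> F \<Longrightarrow> a \<noteq> b \<Longrightarrow> disjoint_in K a b"
    and "\<And>a. a \<in> F \<Longrightarrow> t a \<ge> 0" "\<And>a. a \<in> F \<Longrightarrow> t a *\<^sub>R a \<preceq> x"
  shows "(\<Sum>a\<in>F. t a *\<^sub>R a) \<preceq> x"
  using assms
proof (induction F)
  case empty
  then show ?case by simp
next
  case (insert a F)
  have "convex_cone {v. disjoint_in K a v}"
    using insert.prems by (intro convex_cone_disjoint_in) auto
  then have "(\<Sum>b\<in>F. t b *\<^sub>R b) \<in> {v. disjoint_in K a v}"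
    using insert by (intro convex_cone_sum convex_cone_scaleR) auto
  then have "disjoint_in K (t a *\<^sub>R a) (\<Sum>b\<in>F. t b *\<^sub>R b)"
    using insert.prems(4) disjoint_in_scaleR disjoint_in_commute by blast
  then have "t a *\<^sub>R a + (\<Sum>b\<in>F. t b *\<^sub>R b) \<preceq> x"
    using insert K_subset by (intro disjoint_add_le) auto
  then show ?case using insert.hyps by simp
qed

text \<open>The elements disjoint from a fixed one form a convex set; this is applied to either side.\<close>

lemma disjoint_convex_hulls:
  assumes disj: "\<And>a b. a \<in> A \<Longrightarrow> b \<in> B \<Longrightarrow> disjoint_in K a b"
    and u: "u \<in> convex hull A" and v: "v \<in> convex hull B"
  shows "disjoint_in K u v"
proof -
  have half: "disjoint_in K x w" if x: "\<And>b. b \<in> S \<Longrightarrow> disjoint_in K x b" and w: "w \<in> convex hull S"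
    for x w S
  proof -
    have "S \<noteq> {}" using w by auto
    then have "x \<in> K" using x by (auto simp: disjoint_in_def)
    then have "convex {w. disjoint_in K x w}"
      using convex_cone_disjoint_in by (simp add: convex_cone_def)
    then have "convex hull S \<subseteq> {w. disjoint_in K x w}"
      using x by (intro hull_minimal) auto
    then show ?thesis using w by blast
  qed
  have "disjoint_in K a v" if "a \<in> A" for a
    using half[OF disj v] that by blast
  then have "disjoint_in K v u"
    using half[OF _ u, of v] disjoint_in_commute by blast
  then show ?thesis by (simp add: disjoint_in_commute)
qed

end

section \<open>Disjoint sequences in infinite dimensional lattices\<close>

locale closed_vector_lattice_on = vector_lattice_on Y K
  for Y K :: "'a::real_normed_vector set" +
  assumes closed_K: "closed K"
begin

lemma closed_multiples_below: "closed {s::real. s *\<^sub>R y \<preceq> x}"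
proof -
  have "{s::real. s *\<^sub>R y \<preceq> x} = (\<lambda>s. x - s *\<^sub>R y) -` K" by auto
  then show ?thesis
    by (simp add: closed_K continuous_closed_vimage)
qed

text \<open>Closedness of \<open>K\<close> makes the order Archimedean: if \<open>s *\<^sub>R y \<preceq> x\<close> for arbitrarily large \<open>s\<close>,
  then \<open>- y\<close> is the limit of \<open>x /\<^sub>R s - y\<close> and hence positive.\<close>

lemma max_multiple_below:
  assumes x: "x \<in> K" and y: "y \<in> K" "y \<noteq> 0"
  obtains t where "t \<ge> 0" "t *\<^sub>R y \<preceq> x" "\<And>s. s *\<^sub>R y \<preceq> x \<Longrightarrow> s \<le> t"
proof -
  define S where "S = {s::real. s *\<^sub>R y \<preceq> x}"
  have S0: "0 \<in> S" using x by (simp add: S_def)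
  have bdd: "bdd_above S"
  proof (rule ccontr)
    assume unbdd: "\<not> bdd_above S"
    have "inverse (real (Suc n)) *\<^sub>R x - y \<in> K" for n
    proof -
      obtain s where s: "s \<in> S" "real (Suc n) < s"
        using unbdd by (meson bdd_aboveI not_le)
      have "(x - s *\<^sub>R y) + (s - real (Suc n)) *\<^sub>R y \<in> K"
        using s y by (intro K_add K_scale) (auto simp: S_def)
      then have "x - real (Suc n) *\<^sub>R y \<in> K" by (simp add: algebra_simps)
      then have "inverse (real (Suc n)) *\<^sub>R (x - real (Suc n) *\<^sub>R y) \<in> K"
        by (intro K_scale) auto
      then show ?thesis by (simp add: scaleR_diff_right del: of_nat_Suc)
    qed
    moreover have "(\<lambda>n. inverse (real (Suc n)) *\<^sub>R x - y) \<longlonglongrightarrow> 0 *\<^sub>R x - y"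
      by (intro tendsto_intros LIMSEQ_inverse_real_of_nat)
    ultimately have "- y \<in> K"
      using closed_sequentially[OF closed_K] by fastforce
    then show False using K_pointed y by blast
  qed
  have "Sup S \<in> S"
  proof (rule closed_contains_Sup)
    show "closed S" unfolding S_def by (rule closed_multiples_below)
  qed (use S0 bdd in auto)
  then show thesis
    using cSup_upper[OF _ bdd] S0 by (intro that[of "Sup S"]) (auto simp: S_def)
qed

definition atom :: "'a \<Rightarrow> bool" where
  "atom x \<longleftrightarrow> x \<in> K \<and> x \<noteq> 0 \<and> (\<forall>y\<in>K. y \<preceq> x \<longrightarrow> (\<exists>c. y = c *\<^sub>R x))"

text \<open>If \<open>y \<preceq> x\<close> is not a multiple of \<open>x\<close>, then \<open>x\<close> is incomparable with some multiple
  \<open>s *\<^sub>R y\<close>. The positive and the negative part of \<open>x - s *\<^sub>R y\<close> are disjoint and nonzero, and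
  they are below multiples of \<open>x\<close>.\<close>

lemma disjoint_pair_below_nonatom:
  assumes x: "x \<in> K" "x \<noteq> 0" "\<not> atom x"
  obtains u v where "disjoint_in K u v" "u \<noteq> 0" "v \<noteq> 0" "u \<preceq> x" "v \<preceq> x"
proof -
  obtain y where y: "y \<in> K" "y \<preceq> x" and not_mult: "\<And>c. y \<noteq> c *\<^sub>R x"
    using x by (auto simp: atom_def)
  have "y \<noteq> 0" using not_mult[of 0] by simp
  then obtain t where t: "t \<ge> 0" "t *\<^sub>R y \<preceq> x" and max: "\<And>s. s *\<^sub>R y \<preceq> x \<Longrightarrow> s \<le> t"
    using max_multiple_below[OF x(1) y(1)] by blast
  have "t \<ge> 1" using max[of 1] y by simp
  have "\<exists>s>t. \<not> x \<preceq> s *\<^sub>R y"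
  proof (rule ccontr)
    assume "\<not> ?thesis"
    then have *: "(t + inverse (real (Suc n))) *\<^sub>R y - x \<in> K" for n
      by (metis inverse_positive_iff_positive less_add_same_cancel1 of_nat_0_less_iff zero_less_Suc)
    have "(\<lambda>n. (t + inverse (real (Suc n))) *\<^sub>R y - x) \<longlonglongrightarrow> (t + 0) *\<^sub>R y - x"
      by (intro tendsto_intros LIMSEQ_inverse_real_of_nat)
    then have "x \<preceq> t *\<^sub>R y"
      using closed_sequentially[OF closed_K *] by simp
    then have "x = t *\<^sub>R y" using t by (intro le_K_antisym)
    then have "y = inverse t *\<^sub>R x" using \<open>t \<ge> 1\<close> by simp
    then show False using not_mult by blast
  qed
  then obtain s where s: "s > t" "\<not> x \<preceq> s *\<^sub>R y" by blast
  then have s': "\<not> s *\<^sub>R y \<preceq> x" "s > 0" using max[of s] t by auto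
  define w where "w = x - s *\<^sub>R y"
  define p where "p = sup_K w 0"
  have Y: "x \<in> Y" "y \<in> Y" "w \<in> Y" "0 \<in> Y"
    using x y K_subset by (auto simp: w_def intro: Y_diff Y_scale Y_zero)
  have p: "w \<preceq> p" "p \<in> K" "p \<in> Y"
    using sup_K_left[OF Y(3,4)] sup_K_right[OF Y(3,4)] K_subset by (auto simp: p_def)
  have px: "p \<preceq> x"
    using Y x y s' by (auto simp: p_def w_def intro!: sup_K_least K_scale)
  have disj: "disjoint_in K p (p - w)"
    unfolding disjoint_in_def
  proof (intro conjI ballI impI)
    fix z assume z: "z \<in> K" "z \<preceq> p" "z \<preceq> p - w"
    have "p \<preceq> p - z"
    proof (rule sup_K_least[OF Y(3,4), folded p_def])
      show "p - z \<in> Y" using z p K_subset by (auto intro: Y_diff)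
      show "w \<preceq> p - z" using z(3) by (simp add: algebra_simps)
      show "0 \<preceq> p - z" using z(2) by simp
    qed
    then show "z = 0" using K_pointed z(1) by simp
  qed (use p in auto)
  have "p - w \<in> K" using p by simp
  show thesis
  proof (rule that)
    show "disjoint_in K p (inverse s *\<^sub>R (p - w))"
      using s' by (intro disjoint_in_scaleR disj) simp
    show "p \<noteq> 0" using p(1) s(2) by (auto simp: w_def)
    show "inverse s *\<^sub>R (p - w) \<noteq> 0" using p(2) s' by (auto simp: w_def)
    have "inverse s *\<^sub>R (x - p) \<in> K" using px s' by (intro K_scale) auto
    moreover have "inverse s *\<^sub>R (x - p) = y - inverse s *\<^sub>R (p - w)"
      using s' by (simp add: w_def algebra_simps)
    ultimately have "inverse s *\<^sub>R (p - w) \<preceq> y" by simp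
    then show "inverse s *\<^sub>R (p - w) \<preceq> x" using le_K_trans y(2) by blast
  qed (rule px)
qed

text \<open>Below an element without atoms one splits again and again: of each pair of disjoint
  elements, one joins the sequence and the other one is split further.\<close>

lemma disjoint_sequence_below_atomless:
  assumes x: "x \<in> K" "x \<noteq> 0" and no_atom: "\<And>a. atom a \<Longrightarrow> \<not> a \<preceq> x"
  shows "\<exists>e :: nat \<Rightarrow> 'a. (\<forall>n. e n \<noteq> 0) \<and> (\<forall>m n. m < n \<longrightarrow> disjoint_in K (e m) (e n))"
proof -
  define ok where "ok p \<longleftrightarrow> fst p \<in> K \<and> fst p \<noteq> 0 \<and> fst p \<preceq> x" for p :: "'a \<times> 'a"
  define next_pair where "next_pair p q \<longleftrightarrow>
    disjoint_in K (fst q) (snd q) \<and> snd q \<noteq> 0 \<and> fst q \<preceq> fst p \<and> snd q \<preceq> fst p" for p q :: "'a \<times> 'a"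
  have "\<exists>f. \<forall>n. ok (f n) \<and> next_pair (f n) (f (Suc n))"
  proof (rule dependent_nat_choice)
    show "\<exists>p. ok p" using x by (intro exI[of _ "(x, x)"]) (simp add: ok_def K_zero)
  next
    fix p :: "'a \<times> 'a" and n :: nat assume p: "ok p"
    then have "\<not> atom (fst p)" using no_atom by (auto simp: ok_def)
    then obtain u v where uv: "disjoint_in K u v" "u \<noteq> 0" "v \<noteq> 0" "u \<preceq> fst p" "v \<preceq> fst p"
      using disjoint_pair_below_nonatom p by (auto simp: ok_def)
    moreover have "u \<preceq> x" using uv p le_K_trans by (auto simp: ok_def)
    ultimately show "\<exists>q. ok q \<and> next_pair p q"
      by (intro exI[of _ "(u, v)"]) (auto simp: ok_def next_pair_def disjoint_in_def)
  qed
  then obtain f where f: "\<And>n. ok (f n)" "\<And>n. next_pair (f n) (f (Suc n))" by blast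
  have dec: "fst (f (m + k)) \<preceq> fst (f m)" for m k
  proof (induction k)
    case (Suc k)
    then show ?case using f(2)[of "m + k"] le_K_trans by (auto simp: next_pair_def)
  qed (simp add: K_zero)
  show ?thesis
  proof (intro exI[of _ "\<lambda>n. snd (f (Suc n))"] conjI allI impI)
    show "snd (f (Suc n)) \<noteq> 0" for n using f(2)[of n] by (simp add: next_pair_def)
    fix m n :: nat assume "m < n"
    then obtain k where "n = Suc m + k" using less_iff_Suc_add by auto
    then have "snd (f (Suc n)) \<preceq> fst (f (Suc m))"
      using f(2)[of n] dec[of "Suc m" k] le_K_trans by (auto simp: next_pair_def)
    moreover have "disjoint_in K (fst (f (Suc m))) (snd (f (Suc m)))"
      using f(2)[of m] by (simp add: next_pair_def)
    moreover have "snd (f (Suc n)) \<in> K"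
      using f(2)[of n] by (simp add: next_pair_def disjoint_in_def)
    ultimately show "disjoint_in K (snd (f (Suc m))) (snd (f (Suc n)))"
      using disjoint_in_mono[of "fst (f (Suc m))" "snd (f (Suc m))" "snd (f (Suc n))" "snd (f (Suc m))"]
      by (auto simp: disjoint_in_commute disjoint_in_def K_zero)
  qed
qed

text \<open>Subtract from \<open>x\<close> the largest multiple of each \<open>a \<in> F\<close> below \<open>x\<close>. If the remainder were
  nonzero, the atom \<open>b\<close> below it would be proportional to some \<open>a \<in> F\<close>, and the multiple of \<open>a\<close>
  would not have been largest.\<close>

lemma subset_span_maximal_disjoint_atoms:
  assumes atoms_below: "\<And>x. x \<in> K \<Longrightarrow> x \<noteq> 0 \<Longrightarrow> \<exists>a. atom a \<and> a \<preceq> x"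
    and F: "finite F" "\<And>a. a \<in> F \<Longrightarrow> atom a"
    and disj: "\<And>a b. a \<in> F \<Longrightarrow> b \<in> F \<Longrightarrow> a \<noteq> b \<Longrightarrow> disjoint_in K a b"
    and maximal: "\<And>b. atom b \<Longrightarrow> \<exists>a\<in>F. \<not> disjoint_in K a b"
  shows "K \<subseteq> span F"
proof
  fix x assume x: "x \<in> K"
  have "\<exists>t\<ge>0. t *\<^sub>R a \<preceq> x \<and> (\<forall>s. s *\<^sub>R a \<preceq> x \<longrightarrow> s \<le> t)" if "a \<in> F" for a
    using max_multiple_below[OF x, of a] F(2)[OF that] by (metis atom_def)
  then obtain t where t: "\<And>a. a \<in> F \<Longrightarrow> t a \<ge> 0" "\<And>a. a \<in> F \<Longrightarrow> t a *\<^sub>R a \<preceq> x"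
    and max: "\<And>a s. a \<in> F \<Longrightarrow> s *\<^sub>R a \<preceq> x \<Longrightarrow> s \<le> t a"
    by metis
  define y where "y = (\<Sum>a\<in>F. t a *\<^sub>R a)"
  have FK: "F \<subseteq> K" using F by (auto simp: atom_def)
  have yx: "y \<preceq> x"
    unfolding y_def using F(1) FK x disj t by (intro disjoint_sum_le)
  have "x - y = 0"
  proof (rule ccontr)
    assume "x - y \<noteq> 0"
    then obtain b where b: "atom b" "b \<preceq> x - y" using atoms_below yx by blast
    then obtain a where a: "a \<in> F" "\<not> disjoint_in K a b" using maximal by blast
    have aK: "a \<in> K" "atom a" and bK: "b \<in> K" using a b F by (auto simp: atom_def)
    then obtain z where z: "z \<in> K" "z \<preceq> a" "z \<preceq> b" "z \<noteq> 0"
      using a by (auto simp: disjoint_in_def)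
    then obtain c where c: "z = c *\<^sub>R a"
      using aK by (auto simp: atom_def)
    have "c > 0"
    proof (rule ccontr)
      assume "\<not> c > 0"
      then have "- z \<in> K" using K_scale[of "- c" a] aK c by simp
      then show False using K_pointed z by blast
    qed
    have "t a *\<^sub>R a \<preceq> y"
    proof -
      have "y - t a *\<^sub>R a = (\<Sum>a'\<in>F - {a}. t a' *\<^sub>R a')"
        unfolding y_def using F(1) a(1) by (simp add: sum.remove)
      also have "\<dots> \<in> K"
        using FK t by (intro convex_cone_sum[OF cone] K_scale) auto
      finally show ?thesis .
    qed
    moreover have "z \<preceq> x - y" using z(3) b(2) le_K_trans by blast
    ultimately have "(y - t a *\<^sub>R a) + (x - y - z) \<in> K" by (intro K_add)
    then have "(t a + c) *\<^sub>R a \<preceq> x" by (simp add: c algebra_simps)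
    then show False using max[OF a(1)] \<open>c > 0\<close> by fastforce
  qed
  then have "x = y" by simp
  also have "y \<in> span F"
    unfolding y_def by (intro span_sum span_scale span_base)
  finally show "x \<in> span F" .
qed

lemma infinite_dim_imp_disjoint_sequence:
  assumes inf: "infinite_dim_cone K"
  shows "\<exists>e :: nat \<Rightarrow> 'a. (\<forall>n. e n \<noteq> 0) \<and> (\<forall>m n. m < n \<longrightarrow> disjoint_in K (e m) (e n))"
proof (cases "\<exists>x\<in>K. x \<noteq> 0 \<and> (\<forall>a. atom a \<longrightarrow> \<not> a \<preceq> x)")
  case True
  then show ?thesis using disjoint_sequence_below_atomless by blast
next
  case False
  have extend: "\<exists>b. atom b \<and> (\<forall>a\<in>F. disjoint_in K a b)"
    if "finite F" "\<And>a. a \<in> F \<Longrightarrow> atom a"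
      "\<And>a b. a \<in> F \<Longrightarrow> b \<in> F \<Longrightarrow> a \<noteq> b \<Longrightarrow> disjoint_in K a b" for F
  proof (rule ccontr)
    assume "\<not> ?thesis"
    then have "K \<subseteq> span F"
      using False that by (intro subset_span_maximal_disjoint_atoms) auto
    then have "cone_span K \<subseteq> span F"
      by (auto simp: cone_span_def intro: span_diff)
    then show False using inf that(1) by (auto simp: infinite_dim_cone_def)
  qed
  define P where "P e n b \<longleftrightarrow> atom b \<and> (\<forall>m<n. disjoint_in K (e m) b)"
    for e :: "nat \<Rightarrow> 'a" and n :: nat and b
  have "\<exists>e. \<forall>n. P e n (e n)"
  proof (rule dependent_wellorder_choice)
    fix n :: nat and e assume IH: "\<And>m. m < n \<Longrightarrow> P e m (e m)"
    have "disjoint_in K a b" if ab: "a \<in> e ` {..<n}" "b \<in> e ` {..<n}" "a \<noteq> b" for a b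
    proof -
      obtain i j where ij: "a = e i" "b = e j" "i < n" "j < n" using ab by auto
      then have "i < j \<or> j < i" using ab(3) by (metis linorder_neqE_nat)
      then show ?thesis
        using IH[of i] IH[of j] ij disjoint_in_commute by (auto simp: P_def)
    qed
    then have "\<exists>b. atom b \<and> (\<forall>a\<in>e ` {..<n}. disjoint_in K a b)"
      using IH by (intro extend) (auto simp: P_def)
    then show "\<exists>b. P e n b" by (auto simp: P_def)
  qed (auto simp: P_def)
  then obtain e where "\<And>n. P e n (e n)" by blast
  then show ?thesis by (intro exI[of _ e]) (auto simp: P_def atom_def)
qed

end

section \<open>Sequences in weakly compact sets\<close>

text \<open>The closed convex hulls of the tails of the sequence have a common point \<open>z\<close>. It is a limit
  of finite convex combinations, which use only terms before some \<open>M\<close>, and also of convex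
  combinations of terms from \<open>M\<close> on.\<close>

lemma weakly_compact_imp_close_convex_combinations:
  fixes e :: "nat \<Rightarrow> 'a::real_normed_vector"
  assumes S: "compactin weak_topology S" "closure (convex hull range e) \<subseteq> S" and d: "d > 0"
  obtains M u v where "u \<in> convex hull (e ` {..<M})" "v \<in> convex hull (e ` {M..})" "norm (u - v) < d"
proof -
  define C where "C n = closure (convex hull (e ` {n..}))" for n
  have "(\<Inter>n. C n) \<noteq> {}"
  proof (rule weakly_compact_decreasing_closed_convex[OF S(1)])
    show "convex (C n)" "closed (C n)" for n
      by (simp_all add: C_def convex_closure)
    show "C n \<noteq> {}" for n
      using atLeast_empty_triv by (auto simp: C_def closure_eq_empty convex_hull_eq_empty)
    show "C n \<subseteq> S" for n
      unfolding C_def using S(2) by (meson closure_mono dual_order.trans hull_mono image_mono subset_UNIV)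
    show "decseq C"
      unfolding C_def decseq_def by (auto intro!: closure_mono hull_mono image_mono)
  qed
  then obtain z where z: "\<And>n. z \<in> C n" by blast
  obtain u where u: "u \<in> convex hull range e" "dist u z < d / 2"
    using z[of 0] d by (auto simp: C_def closure_approachable dest!: spec[of _ "d / 2"])
  obtain T where T: "finite T" "T \<subseteq> range e" "u \<in> convex hull T"
    using u(1) by (auto simp: convex_hull_explicit)
  obtain N where N: "finite N" "T = e ` N"
    using finite_subset_image[of T e UNIV] T by auto
  obtain M where M: "N \<subseteq> {..<M}"
    using finite_nat_iff_bounded N(1) by blast
  obtain v where v: "v \<in> convex hull (e ` {M..})" "dist v z < d / 2"
    using z[of M] d by (auto simp: C_def closure_approachable dest!: spec[of _ "d / 2"])
  show thesis
  proof (rule that)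
    show "u \<in> convex hull (e ` {..<M})"
      using T(3) hull_mono[of T "e ` {..<M}" convex] M N by blast
    have "dist u v < d" by (rule dist_triangle_half_l[OF u(2) v(2)])
    then show "norm (u - v) < d" by (simp add: dist_norm)
  qed (rule v)
qed

section \<open>Reflexive cones with a bounded base\<close>

text \<open>If \<open>0 \<in> B\<close>, then with \<open>b \<in> B\<close> also \<open>b / 2 \<in> B\<close>, so that scaling factors are not unique.\<close>

lemma zero_notin_cone_base:
  assumes B: "cone_base P B" and x: "x \<in> P" "x \<noteq> 0"
  shows "0 \<notin> B"
proof
  assume B0: "0 \<in> B"
  obtain t :: real where t: "t > 0" "x /\<^sub>R t \<in> B"
    using B x by (auto simp: cone_base_def)
  have "(1/2) *\<^sub>R 0 + (1/2) *\<^sub>R (x /\<^sub>R t) \<in> B"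
    using B B0 t by (intro convexD) (auto simp: cone_base_def)
  then have "x /\<^sub>R (2 * t) \<in> B" by simp
  moreover have "\<exists>!t::real. t > 0 \<and> x /\<^sub>R t \<in> B"
    using B x by (auto simp: cone_base_def)
  ultimately have "2 * t = t" using t by (metis mult_pos_pos zero_less_numeral)
  then show False using t by simp
qed

theorem corollary7p4:
  fixes P B :: "'a::banach set"
  assumes "reflexive_cone P"
    and "cone_base P B" and "closed B" and "bounded B"
  shows "\<not> (\<exists>K. K \<subseteq> P \<and> convex_cone K \<and> closed K \<and> infinite_dim_cone K \<and>
               locally_solid_vector_lattice (cone_span P) K)"
proof (rule notI, elim exE conjE)
  fix K
  assume KP: "K \<subseteq> P" and "closed K" and inf: "infinite_dim_cone K"
    and solid: "locally_solid_vector_lattice (cone_span P) K"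
  interpret closed_vector_lattice_on "cone_span P" K
    using solid \<open>closed K\<close>
    by unfold_locales (auto simp: locally_solid_vector_lattice_def)
  obtain e :: "nat \<Rightarrow> 'a"
    where e: "(\<forall>n. e n \<noteq> 0) \<and> (\<forall>m n. m < n \<longrightarrow> disjoint_in K (e m) (e n))"
    using infinite_dim_imp_disjoint_sequence[OF inf] ..
  have e0: "e n \<noteq> 0" and e_disj: "m < n \<Longrightarrow> disjoint_in K (e m) (e n)" for m n
    using e by simp_all
  have eK: "e n \<in> K" for n
    using e_disj[of n "Suc n"] by (simp add: disjoint_in_def)
  have P: "convex_cone P" "compactin weak_topology (P \<inter> cball 0 1)"
    using assms(1) by (simp_all add: reflexive_cone_def)
  have B: "convex B" "B \<subseteq> P"
    using assms(2) by (simp_all add: cone_base_def)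

  obtain R where R: "R > 0" "\<And>b. b \<in> B \<Longrightarrow> norm b \<le> R"
    using assms(4) by (auto simp: bounded_pos)
  \<comment> \<open>Rescaling moves the base into the weakly compact set \<open>P \<inter> cball 0 1\<close>.\<close>
  define B' where "B' = (\<lambda>b. inverse R *\<^sub>R b) ` B"
  have B': "convex B'" "closed B'"
    unfolding B'_def by (auto intro: convex_scaling closed_scaling B assms(3))
  have B'_sub: "B' \<subseteq> P \<inter> cball 0 1"
    using R B P(1) by (auto simp: B'_def convex_cone_scaleR field_simps)
  have "0 \<notin> B"
    using eK[of 0] e0[of 0] KP by (intro zero_notin_cone_base[OF assms(2), of "e 0"]) auto
  then have "0 \<notin> B'" using R by (auto simp: B'_def)
  then obtain m where m: "m > 0" "ball 0 m \<subseteq> - B'"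
    using openE[of "- B'" 0] B'(2) open_Compl by (metis Compl_iff)
  have m_le: "m \<le> norm b" if "b \<in> B'" for b
    using m(2) that by force

  have "\<exists>t>0. t *\<^sub>R e n \<in> B'" for n
  proof -
    obtain t :: real where t: "t > 0" "e n /\<^sub>R t \<in> B"
      using assms(2) e0[of n] eK[of n] KP by (auto simp: cone_base_def)
    then have "(inverse R * inverse t) *\<^sub>R e n \<in> B'"
      by (auto simp: B'_def intro!: image_eqI[of _ _ "e n /\<^sub>R t"])
    then show ?thesis using t R by (intro exI[of _ "inverse R * inverse t"]) auto
  qed
  then obtain t where t: "\<And>n. t n > 0" "\<And>n. t n *\<^sub>R e n \<in> B'" by metis
  define x where "x n = t n *\<^sub>R e n" for n
  have x_disj: "disjoint_in K (x m) (x n)" if "m < n" for m n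
    using disjoint_in_scaleR[OF _ less_imp_le[OF t(1)]] e_disj[OF that] disjoint_in_commute
    unfolding x_def by metis

  obtain a where a: "a > 0" and a_solid: "\<And>y z. y \<in> cone_span P \<Longrightarrow> z \<in> cone_span P \<Longrightarrow>
      lattice_abs (cone_span P) K z - lattice_abs (cone_span P) K y \<in> K \<Longrightarrow> norm y \<le> a * norm z"
    using solid by (auto simp: locally_solid_vector_lattice_def ordered_by_def)
  have xB': "convex hull S \<subseteq> B'" if "S \<subseteq> range x" for S
    using that t(2) B'(1) by (intro hull_minimal) (auto simp: x_def)
  then have hull: "closure (convex hull range x) \<subseteq> P \<inter> cball 0 1"
    using closure_minimal[OF _ B'(2)] B'_sub by (metis order_trans subset_refl)
  have "2 * m / a > 0" using a m by simp
  then obtain M u v where u: "u \<in> convex hull (x ` {..<M})"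
    and v: "v \<in> convex hull (x ` {M..})" and uv: "norm (u - v) < 2 * m / a"
    using weakly_compact_imp_close_convex_combinations[OF P(2) hull] by blast
  have disj: "disjoint_in K u v"
    by (rule disjoint_convex_hulls[OF _ u v]) (auto intro: x_disj)
  then have K: "u \<in> K" "v \<in> K" by (auto simp: disjoint_in_def)
  then have Y: "u \<in> cone_span P" "v \<in> cone_span P" using K_subset by auto
  \<comment> \<open>The midpoint of \<open>u\<close> and \<open>v\<close> stays in the base, which bounds \<open>norm (u + v)\<close> from below.\<close>
  have "u \<in> B'" "v \<in> B'"
    using u v xB'[of "x ` {..<M}"] xB'[of "x ` {M..}"] by auto
  then have "(1/2) *\<^sub>R u + (1/2) *\<^sub>R v \<in> B'"
    using B'(1) by (intro convexD) auto
  then have "2 * m \<le> 2 * norm ((1/2) *\<^sub>R (u + v))"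
    using m_le by (simp add: scaleR_add_right)
  also have "\<dots> = norm (u + v)" by simp
  also have "\<dots> \<le> a * norm (u - v)"
    using lattice_abs_diff_disjoint[OF disj] lattice_abs_of_positive[OF K_add[OF K]]
    by (intro a_solid Y_add Y_diff Y) (simp add: K_zero)
  also have "\<dots> < 2 * m"
    using uv a by (simp add: field_simps)
  finally show False by simp
qed

end
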